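(* Let $X:[0,\infty]\to s\mathbf{Set}$ be a diagram (functor) of simplicial sets. Then the ep-metric space $\Re(X)$ has as underlying set the set of vertices of the simplicial set $X_\infty$. Its metric $d$ is given as follows. If $x,y$ are vertices in the same path component of $X_\infty$, then $$d(x,y)=\inf_{P}\Big\{\sum_i s_i\Big\},$$ where $P$ ranges over all polygonal paths from $x$ to $y$, i.e. finite sequences of $1$-simplices $\omega_i:\Delta^1\to X_{s_i}$ (with $s_i\in[0,\infty]$) whose images under $X_{s_i}\to X_\infty$ form a path $x=x_0\leftrightarrows x_1\leftrightarrows\dots\leftrightarrows x_k=y$ of $1$-simplices in $X_\infty$. If $x$ and $y$ are in distinct path components of $X_\infty$, then $d(x,y)=\infty$.
   Context: An ep-metric space (extended pseudo-metric space) is a set $Y$ with a function $d:Y\times Y\to[0,\infty]$ such that $d(x,x)=0$, $d(x,y)=d(y,x)$ and $d(x,z)\le d(x,y)+d(y,z)$. A morphism $f:(X,d_X)\to(Y,d_Y)$ is a function with $d_Y(f(x),f(y))\le d_X(x,y)$ for all $x,y$. The resulting category $ep\text{-}\mathbf{Met}$ is cocomplete. The interval $[0,\infty]$ is regarded as a poset category; for a functor $X:[0,\infty]\to s\mathbf{Set}$ write $X_s$ for its value at $s$, so $X_\infty$ is its value at the terminal object $\infty$. For a simplicial set $K$ and $s\in[0,\infty]$, $L_sK:[0,\infty]\to s\mathbf{Set}$ is the diagram with $(L_sK)_t=\emptyset$ for $t<s$ and $(L_sK)_t=K$ for $t\ge s$ (with identity transition maps); maps $L_sK\to X$ correspond to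 simplicial set maps $K\to X_s$. The category of simplices $\mathbf{\Delta}/X$ has objects the maps $L_s\Delta^n\to X$ ($s\in[0,\infty]$, $n\ge0$) and morphisms the maps $L_t\Delta^m\to L_s\Delta^n$ over $X$; such a map consists of a relation $s\le t$ and a simplicial map $\theta:\Delta^m\to\Delta^n$. $U^n_s$ is the ep-metric space with underlying set $\mathbf n=\{0,1,\dots,n\}$ and $d(i,j)=s$ for $i\neq j$. A morphism $L_t\Delta^m\to L_s\Delta^n$, consisting of a relation $s\le t$ and a simplicial map $\theta:\Delta^m\to\Delta^n$, induces the morphism $\theta:U^m_t\to U^n_s$ given by the vertex function $\theta:\mathbf m\to\mathbf n$. The realization of $X$ is the colimit in $ep\text{-}\mathbf{Met}$ $$\Re(X)=\varinjlim_{L_s\Delta^n\to X}U^n_s$$ indexed by $\mathbf{\Delta}/X$. In a polygonal path each $1$-simplex $\omega_i$ may connect consecutive vertices in either direction, and the path of length $k=0$ (with sum $0$) is allowed when $x=y$. *)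

theory Defs
  imports "HOL-Library.Extended_Nonnegative_Real" "HOL-Library.FuncSet"
begin

section \<open>Extended pseudo-metric spaces\<close>

record 'a ep_space =
  points :: "'a set"
  edist :: "'a \<Rightarrow> 'a \<Rightarrow> ennreal"

definition ep_metric_space :: "'a ep_space \<Rightarrow> bool" where
  "ep_metric_space Y \<longleftrightarrow>
     (\<forall>x\<in>points Y. edist Y x x = 0) \<and>
     (\<forall>x\<in>points Y. \<forall>y\<in>points Y. edist Y x y = edist Y y x) \<and>
     (\<forall>x\<in>points Y. \<forall>y\<in>points Y. \<forall>z\<in>points Y. edist Y x z \<le> edist Y x y + edist Y y z)"

text \<open>Here and below, maps are extensional functions, so that equality of maps is equality in HOL.\<close>

definition ep_hom :: "'a ep_space \<Rightarrow> 'b ep_space \<Rightarrow> ('a \<Rightarrow> 'b) set" where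
  "ep_hom Y Z = {f \<in> points Y \<rightarrow>\<^sub>E points Z.
     \<forall>x\<in>points Y. \<forall>y\<in>points Y. edist Z (f x) (f y) \<le> edist Y x y}"

text \<open>
  A diagram of ep-metric spaces is given by a set \<open>I\<close> of objects, sets \<open>H j k\<close> of morphisms from
  \<open>j\<close> to \<open>k\<close>, the space \<open>D j\<close> at each object and the map \<open>F j k m\<close> from \<open>D j\<close> to \<open>D k\<close>
  induced by \<open>m \<in> H j k\<close>. Cocones do not involve the composition of the index category.
\<close>

definition ep_cocone ::
  "'j set \<Rightarrow> ('j \<Rightarrow> 'j \<Rightarrow> 'm set) \<Rightarrow> ('j \<Rightarrow> 'a ep_space) \<Rightarrow> ('j \<Rightarrow> 'j \<Rightarrow> 'm \<Rightarrow> 'a \<Rightarrow> 'a) \<Rightarrow>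
   'b ep_space \<Rightarrow> ('j \<Rightarrow> 'a \<Rightarrow> 'b) \<Rightarrow> bool" where
  "ep_cocone I H D F Y g \<longleftrightarrow>
     ep_metric_space Y \<and>
     (\<forall>j\<in>I. g j \<in> ep_hom (D j) Y) \<and>
     (\<forall>j\<in>I. \<forall>k\<in>I. \<forall>m\<in>H j k. \<forall>x\<in>points (D j). g k (F j k m x) = g j x)"

text \<open>
  HOL cannot quantify over types inside a formula, so the type \<open>'c\<close> of points of the test
  spaces is a parameter; the universal property is the statement for all \<open>'c\<close>.
\<close>

definition is_ep_colimit ::
  "'c itself \<Rightarrow> 'j set \<Rightarrow> ('j \<Rightarrow> 'j \<Rightarrow> 'm set) \<Rightarrow> ('j \<Rightarrow> 'a ep_space) \<Rightarrow>
   ('j \<Rightarrow> 'j \<Rightarrow> 'm \<Rightarrow> 'a \<Rightarrow> 'a) \<Rightarrow> 'b ep_space \<Rightarrow> ('j \<Rightarrow> 'a \<Rightarrow> 'b) \<Rightarrow> bool" where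
  "is_ep_colimit T I H D F Y g \<longleftrightarrow>
     ep_cocone I H D F Y g \<and>
     (\<forall>(Z :: 'c ep_space) f. ep_cocone I H D F Z f \<longrightarrow>
        (\<exists>!h. h \<in> ep_hom Y Z \<and> (\<forall>j\<in>I. \<forall>x\<in>points (D j). h (g j x) = f j x)))"

section \<open>Simplicial sets\<close>

text \<open>The morphisms from \<open>{0,\<dots>,m}\<close> to \<open>{0,\<dots>,n}\<close> in the simplex category.\<close>

definition ordinal_hom :: "nat \<Rightarrow> nat \<Rightarrow> (nat \<Rightarrow> nat) set" where
  "ordinal_hom m n = {\<theta> \<in> {..m} \<rightarrow>\<^sub>E {..n}. mono_on {..m} \<theta>}"

text \<open>For \<open>\<theta> \<in> ordinal_hom m n\<close>, \<open>sact K m n \<theta>\<close> is the induced map from \<open>n\<close>-simplices to \<open>m\<close>-simplices.\<close>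

record 'a sset =
  simplices :: "nat \<Rightarrow> 'a set"
  sact :: "nat \<Rightarrow> nat \<Rightarrow> (nat \<Rightarrow> nat) \<Rightarrow> 'a \<Rightarrow> 'a"

definition simplicial_set :: "'a sset \<Rightarrow> bool" where
  "simplicial_set K \<longleftrightarrow>
     (\<forall>m n. \<forall>\<theta>\<in>ordinal_hom m n. sact K m n \<theta> \<in> simplices K n \<rightarrow> simplices K m) \<and>
     (\<forall>n. \<forall>x\<in>simplices K n. sact K n n (\<lambda>i\<in>{..n}. i) x = x) \<and>
     (\<forall>l m n. \<forall>\<theta>\<in>ordinal_hom l m. \<forall>\<eta>\<in>ordinal_hom m n. \<forall>x\<in>simplices K n.
        sact K l n (compose {..l} \<eta> \<theta>) x = sact K l m \<theta> (sact K m n \<eta> x))"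

definition sset_hom :: "'a sset \<Rightarrow> 'b sset \<Rightarrow> (nat \<Rightarrow> 'a \<Rightarrow> 'b) set" where
  "sset_hom K L = {f.
     (\<forall>n. f n \<in> simplices K n \<rightarrow>\<^sub>E simplices L n) \<and>
     (\<forall>m n. \<forall>\<theta>\<in>ordinal_hom m n. \<forall>x\<in>simplices K n.
        f m (sact K m n \<theta> x) = sact L m n \<theta> (f n x))}"

definition standard_simplex :: "nat \<Rightarrow> (nat \<Rightarrow> nat) sset" where
  "standard_simplex n =
     \<lparr>simplices = (\<lambda>m. ordinal_hom m n), sact = (\<lambda>l m \<theta> \<alpha>. compose {..l} \<alpha> \<theta>)\<rparr>"

text \<open>The map from \<open>{0}\<close> with value \<open>i\<close>; it is the vertex \<open>i\<close> of a standard simplex.\<close>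

definition point_map :: "nat \<Rightarrow> nat \<Rightarrow> nat" where
  "point_map i = (\<lambda>_\<in>{..0}. i)"

definition vertices :: "'a sset \<Rightarrow> 'a set" where
  "vertices K = simplices K 0"

definition initial_vertex :: "'a sset \<Rightarrow> 'a \<Rightarrow> 'a" where
  "initial_vertex K e = sact K 0 1 (point_map 0) e"

definition terminal_vertex :: "'a sset \<Rightarrow> 'a \<Rightarrow> 'a" where
  "terminal_vertex K e = sact K 0 1 (point_map 1) e"

definition joins :: "'a sset \<Rightarrow> 'a \<Rightarrow> 'a \<Rightarrow> 'a \<Rightarrow> bool" where
  "joins K e x y \<longleftrightarrow>
     (initial_vertex K e = x \<and> terminal_vertex K e = y) \<or>
     (initial_vertex K e = y \<and> terminal_vertex K e = x)"

definition same_path_component :: "'a sset \<Rightarrow> 'a \<Rightarrow> 'a \<Rightarrow> bool" where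
  "same_path_component K =
     equivclp (\<lambda>x y. \<exists>e\<in>simplices K 1. initial_vertex K e = x \<and> terminal_vertex K e = y)"

section \<open>Diagrams of simplicial sets indexed by the interval\<close>

record 'a sdiagram =
  stage :: "ennreal \<Rightarrow> 'a sset"
  transition :: "ennreal \<Rightarrow> ennreal \<Rightarrow> nat \<Rightarrow> 'a \<Rightarrow> 'a"

definition simplicial_diagram :: "'a sdiagram \<Rightarrow> bool" where
  "simplicial_diagram X \<longleftrightarrow>
     (\<forall>s. simplicial_set (stage X s)) \<and>
     (\<forall>s t. s \<le> t \<longrightarrow> transition X s t \<in> sset_hom (stage X s) (stage X t)) \<and>
     (\<forall>s n. \<forall>x\<in>simplices (stage X s) n. transition X s s n x = x) \<and>
     (\<forall>s t u n. s \<le> t \<longrightarrow> t \<le> u \<longrightarrow> (\<forall>x\<in>simplices (stage X s) n.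
        transition X s u n x = transition X t u n (transition X s t n x)))"

definition sdiagram_hom ::
  "'a sdiagram \<Rightarrow> 'b sdiagram \<Rightarrow> (ennreal \<Rightarrow> nat \<Rightarrow> 'a \<Rightarrow> 'b) set" where
  "sdiagram_hom X Y = {f.
     (\<forall>s. f s \<in> sset_hom (stage X s) (stage Y s)) \<and>
     (\<forall>s t n. s \<le> t \<longrightarrow> (\<forall>x\<in>simplices (stage X s) n.
        f t n (transition X s t n x) = transition Y s t n (f s n x)))}"

definition free_diagram :: "ennreal \<Rightarrow> 'a sset \<Rightarrow> 'a sdiagram" where
  "free_diagram s K =
     \<lparr>stage = (\<lambda>t. if s \<le> t then K else \<lparr>simplices = (\<lambda>_. {}), sact = sact K\<rparr>),
      transition = (\<lambda>t u n. \<lambda>x\<in>(if s \<le> t then simplices K n else {}). x)\<rparr>"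

section \<open>Category of simplices and realization\<close>

type_synonym 'a diagram_simplex = "ennreal \<times> nat \<times> (ennreal \<Rightarrow> nat \<Rightarrow> (nat \<Rightarrow> nat) \<Rightarrow> 'a)"

definition simplex_objects :: "'a sdiagram \<Rightarrow> 'a diagram_simplex set" where
  "simplex_objects X =
     {(s, n, \<sigma>). \<sigma> \<in> sdiagram_hom (free_diagram s (standard_simplex n)) X}"

fun simplex_homs ::
  "'a diagram_simplex \<Rightarrow> 'a diagram_simplex \<Rightarrow>
   (ennreal \<Rightarrow> nat \<Rightarrow> (nat \<Rightarrow> nat) \<Rightarrow> nat \<Rightarrow> nat) set" where
  "simplex_homs (t, m, \<tau>) (s, n, \<sigma>) =
     {\<Theta> \<in> sdiagram_hom (free_diagram t (standard_simplex m)) (free_diagram s (standard_simplex n)).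
        \<forall>u k. \<forall>\<alpha>\<in>simplices (stage (free_diagram t (standard_simplex m)) u) k.
          \<sigma> u k (\<Theta> u k \<alpha>) = \<tau> u k \<alpha>}"

definition uniform_space :: "nat \<Rightarrow> ennreal \<Rightarrow> nat ep_space" where
  "uniform_space n s = \<lparr>points = {..n}, edist = (\<lambda>i j. if i = j then 0 else s)\<rparr>"

fun simplex_space :: "'a diagram_simplex \<Rightarrow> nat ep_space" where
  "simplex_space (s, n, \<sigma>) = uniform_space n s"

text \<open>
  The vertex function of a morphism with source parameter \<open>t\<close>. All its components from level \<open>t\<close>
  on agree; it is read off from the one at level \<open>t\<close>.
\<close>

fun vertex_function ::
  "'a diagram_simplex \<Rightarrow> 'a diagram_simplex \<Rightarrow>
   (ennreal \<Rightarrow> nat \<Rightarrow> (nat \<Rightarrow> nat) \<Rightarrow> nat \<Rightarrow> nat) \<Rightarrow> nat \<Rightarrow> nat" where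
  "vertex_function (t, m, \<tau>) (s, n, \<sigma>) \<Theta> i = \<Theta> t 0 (point_map i) 0"

definition is_realization ::
  "'c itself \<Rightarrow> 'a sdiagram \<Rightarrow> 'b ep_space \<Rightarrow> ('a diagram_simplex \<Rightarrow> nat \<Rightarrow> 'b) \<Rightarrow> bool" where
  "is_realization T X Y g \<longleftrightarrow>
     is_ep_colimit T (simplex_objects X) simplex_homs simplex_space vertex_function Y g"

text \<open>
  The map from \<open>U\<^sup>n\<^sub>s\<close> to the vertices of \<open>X\<^sub>\<infinity>\<close> given by the vertices of the image of the simplex
  at level \<open>\<infinity>\<close>.
\<close>

fun vertex_cocone :: "'a diagram_simplex \<Rightarrow> nat \<Rightarrow> 'a" where
  "vertex_cocone (s, n, \<sigma>) = (\<lambda>i\<in>{..n}. \<sigma> \<infinity> 0 (point_map i))"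

section \<open>Polygonal paths\<close>

fun polygonal_path :: "'a sdiagram \<Rightarrow> 'a \<Rightarrow> (ennreal \<times> 'a) list \<Rightarrow> 'a \<Rightarrow> bool" where
  "polygonal_path X x [] y \<longleftrightarrow> x = y"
| "polygonal_path X x ((s, \<omega>) # P) y \<longleftrightarrow>
     \<omega> \<in> simplices (stage X s) 1 \<and>
     (\<exists>z. joins (stage X \<infinity>) (transition X s \<infinity> 1 \<omega>) x z \<and> polygonal_path X z P y)"

definition path_length :: "(ennreal \<times> 'a) list \<Rightarrow> ennreal" where
  "path_length P = sum_list (map fst P)"

end

theory Submission
  imports Defs
begin

text \<open>
  Every vertex of \<open>X\<^sub>\<infinity>\<close> is classified by an object \<open>L\<^sub>\<infinity>\<Delta>\<^sup>0 \<rightarrow> X\<close>, and since \<open>\<infinity>\<close> is terminal this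
  object maps to every simplex \<open>L\<^sub>s\<Delta>\<^sup>n \<rightarrow> X\<close> that has it as a vertex. So a cocone is determined by,
  and factors through, a function on the vertices of \<open>X\<^sub>\<infinity>\<close>. The 1-simplices of \<open>X\<^sub>s\<close> bound the
  distance of their endpoints by \<open>s\<close>, and the path metric is the largest metric obeying these bounds.
\<close>

section \<open>Simplices and classifying maps\<close>

lemma point_map_in_ordinal_hom: "i \<le> n \<Longrightarrow> point_map i \<in> ordinal_hom 0 n"
  by (auto simp: ordinal_hom_def point_map_def mono_on_def)

lemma ordinal_hom_0_le: "\<alpha> \<in> ordinal_hom 0 n \<Longrightarrow> \<alpha> 0 \<le> n"
  by (auto simp: ordinal_hom_def)

text \<open>Extensionality makes a map on \<open>{0}\<close> determined by its value at
  \<open>0\<close>. This brings a vertex of a standard simplex back to the form in which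
  \<open>vertex_cocone\<close> evaluates it.\<close>

lemma point_map_eq: "\<alpha> \<in> ordinal_hom 0 n \<Longrightarrow> point_map (\<alpha> 0) = \<alpha>"
  by (auto simp: ordinal_hom_def point_map_def PiE_def extensional_def fun_eq_iff)

lemma compose_in_ordinal_hom:
  assumes "\<theta> \<in> ordinal_hom l m" "\<eta> \<in> ordinal_hom m n"
  shows "compose {..l} \<eta> \<theta> \<in> ordinal_hom l n"
proof -
  have \<theta>: "\<theta> i \<le> m" "i \<le> j \<Longrightarrow> j \<le> l \<Longrightarrow> \<theta> i \<le> \<theta> j" if "i \<le> l" for i j
    using assms(1) that by (auto simp: ordinal_hom_def mono_on_def)
  have \<eta>: "\<eta> i \<le> n" "i \<le> j \<Longrightarrow> j \<le> m \<Longrightarrow> \<eta> i \<le> \<eta> j" if "i \<le> m" for i j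
    using assms(2) that by (auto simp: ordinal_hom_def mono_on_def)
  show ?thesis
    using \<theta> \<eta> by (auto simp: ordinal_hom_def mono_on_def compose_def)
qed

lemma compose_point_map: "i \<le> m \<Longrightarrow> compose {..0} \<eta> (point_map i) = point_map (\<eta> i)"
  by (auto simp: compose_def point_map_def)

lemma simplicial_set_standard_simplex: "simplicial_set (standard_simplex n)"
proof -
  \<comment> \<open>Both sides agree because \<open>\<theta>\<close> takes values in
    \<open>{..m}\<close>, where the restriction built into \<open>compose {..m}\<close> has no
    effect.\<close>
  have "compose {..l} \<alpha> (compose {..l} \<eta> \<theta>) = compose {..l} (compose {..m} \<alpha> \<eta>) \<theta>"
    if "\<theta> \<in> ordinal_hom l m" for l m \<theta> and \<eta> \<alpha> :: "nat \<Rightarrow> nat"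
    using that by (auto simp: ordinal_hom_def compose_def fun_eq_iff)
  moreover have "compose {..k} \<alpha> (\<lambda>i\<in>{..k}. i) = \<alpha>" if "\<alpha> \<in> ordinal_hom k n" for k \<alpha>
    using that by (auto simp: ordinal_hom_def compose_def PiE_def extensional_def fun_eq_iff)
  ultimately show ?thesis
    by (auto simp: simplicial_set_def standard_simplex_def compose_in_ordinal_hom)
qed

text \<open>Lets the Yoneda construction be applied to a free diagram itself, which produces
  morphisms between objects of the category of simplices.\<close>

lemma simplicial_diagram_free_diagram:
  assumes "simplicial_set K"
  shows "simplicial_diagram (free_diagram s K)"
proof -
  let ?L = "free_diagram s K"
  have 1: "simplicial_set (stage ?L t)" for t
    using assms by (cases "s \<le> t") (simp_all add: free_diagram_def simplicial_set_def)
  have 2: "transition ?L t u \<in> sset_hom (stage ?L t) (stage ?L u)" if "t \<le> u" for t u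
  proof (cases "s \<le> t")
    case True
    then have "s \<le> u"
      using that by (rule order_trans)
    with True assms show ?thesis
      by (auto simp: free_diagram_def simplicial_set_def sset_hom_def)
  qed (simp add: free_diagram_def sset_hom_def restrict_def)
  have 3: "transition ?L t u n x = transition ?L v u n (transition ?L t v n x)"
    if "t \<le> v" "x \<in> simplices (stage ?L t) n" for t u v n x
  proof (cases "s \<le> t")
    case True
    then have "s \<le> v"
      using that(1) by (rule order_trans)
    with True that(2) show ?thesis
      by (simp add: free_diagram_def)
  qed (use that(2) in \<open>simp add: free_diagram_def\<close>)
  have 4: "transition ?L t t n x = x" if "x \<in> simplices (stage ?L t) n" for t n x
    using that by (simp add: free_diagram_def split: if_splits)
  show ?thesis
    unfolding simplicial_diagram_def
    by (intro conjI allI impI ballI) (fact 1, erule 2, erule 4, erule (1) 3)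
qed

section \<open>The axioms of simplicial sets, diagrams and their maps as rules\<close>

lemma sact_in_simplices:
  "\<lbrakk>simplicial_set K; \<theta> \<in> ordinal_hom m n; x \<in> simplices K n\<rbrakk> \<Longrightarrow> sact K m n \<theta> x \<in> simplices K m"
  by (auto simp: simplicial_set_def)

lemma sact_compose:
  "\<lbrakk>simplicial_set K; \<theta> \<in> ordinal_hom l m; \<eta> \<in> ordinal_hom m n; x \<in> simplices K n\<rbrakk>
    \<Longrightarrow> sact K l n (compose {..l} \<eta> \<theta>) x = sact K l m \<theta> (sact K m n \<eta> x)"
  by (simp add: simplicial_set_def)

lemma sact_ident:
  "\<lbrakk>simplicial_set K; x \<in> simplices K n\<rbrakk> \<Longrightarrow> sact K n n (\<lambda>i\<in>{..n}. i) x = x"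
  by (simp add: simplicial_set_def)

lemma sset_hom_in_simplices:
  "\<lbrakk>f \<in> sset_hom K L; x \<in> simplices K n\<rbrakk> \<Longrightarrow> f n x \<in> simplices L n"
  by (auto simp: sset_hom_def)

lemma sset_hom_sact:
  "\<lbrakk>f \<in> sset_hom K L; \<theta> \<in> ordinal_hom m n; x \<in> simplices K n\<rbrakk>
    \<Longrightarrow> f m (sact K m n \<theta> x) = sact L m n \<theta> (f n x)"
  by (simp add: sset_hom_def)

lemma simplicial_set_stage: "simplicial_diagram X \<Longrightarrow> simplicial_set (stage X s)"
  by (simp add: simplicial_diagram_def)

lemma transition_sset_hom:
  "\<lbrakk>simplicial_diagram X; s \<le> t\<rbrakk> \<Longrightarrow> transition X s t \<in> sset_hom (stage X s) (stage X t)"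
  unfolding simplicial_diagram_def by blast

lemma transition_self:
  "\<lbrakk>simplicial_diagram X; x \<in> simplices (stage X s) n\<rbrakk> \<Longrightarrow> transition X s s n x = x"
  unfolding simplicial_diagram_def by blast

lemma transition_transition:
  "\<lbrakk>simplicial_diagram X; s \<le> t; t \<le> u; x \<in> simplices (stage X s) n\<rbrakk>
    \<Longrightarrow> transition X t u n (transition X s t n x) = transition X s u n x"
  unfolding simplicial_diagram_def by metis

lemma sdiagram_hom_sset_hom:
  "f \<in> sdiagram_hom X Y \<Longrightarrow> f s \<in> sset_hom (stage X s) (stage Y s)"
  by (auto simp: sdiagram_hom_def)

lemma sdiagram_hom_transition:
  "\<lbrakk>f \<in> sdiagram_hom X Y; s \<le> t; x \<in> simplices (stage X s) n\<rbrakk>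
    \<Longrightarrow> f t n (transition X s t n x) = transition Y s t n (f s n x)"
  by (simp add: sdiagram_hom_def)

section \<open>The diagrams \<open>L\<^sub>s\<Delta>\<^sup>n\<close> and the Yoneda
  correspondence\<close>

lemma simplices_free_diagram_standard_simplex:
  "simplices (stage (free_diagram s (standard_simplex n)) u) k = (if s \<le> u then ordinal_hom k n else {})"
  by (simp add: free_diagram_def standard_simplex_def)

lemma sact_free_diagram_standard_simplex:
  "sact (stage (free_diagram s (standard_simplex n)) u) l m \<theta> \<alpha> = compose {..l} \<alpha> \<theta>"
  by (simp add: free_diagram_def standard_simplex_def)

lemma transition_free_diagram_standard_simplex:
  "\<lbrakk>s \<le> t; \<alpha> \<in> ordinal_hom k n\<rbrakk>
    \<Longrightarrow> transition (free_diagram s (standard_simplex n)) t u k \<alpha> = \<alpha>"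
  by (simp add: free_diagram_def standard_simplex_def)

lemmas free_diagram_standard_simplex_simps =
  simplices_free_diagram_standard_simplex sact_free_diagram_standard_simplex
  transition_free_diagram_standard_simplex

text \<open>The map \<open>L\<^sub>s\<Delta>\<^sup>n \<rightarrow> X\<close> corresponding to \<open>\<omega>\<close> under the Yoneda lemma.\<close>

definition simplex_map ::
  "'a sdiagram \<Rightarrow> ennreal \<Rightarrow> nat \<Rightarrow> 'a \<Rightarrow> ennreal \<Rightarrow> nat \<Rightarrow> (nat \<Rightarrow> nat) \<Rightarrow> 'a" where
  "simplex_map X s n \<omega> = (\<lambda>u k. \<lambda>\<alpha>\<in>(if s \<le> u then ordinal_hom k n else {}).
     transition X s u k (sact (stage X s) k n \<alpha> \<omega>))"

lemma simplex_map_apply: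
  "\<lbrakk>s \<le> u; \<alpha> \<in> ordinal_hom k n\<rbrakk>
    \<Longrightarrow> simplex_map X s n \<omega> u k \<alpha> = transition X s u k (sact (stage X s) k n \<alpha> \<omega>)"
  by (simp add: simplex_map_def)

text \<open>Compatibility with operators is functoriality of \<open>sact\<close> at level
  \<open>s\<close> followed by naturality of the transition to \<open>u\<close>; compatibility with
  transitions is functoriality of \<open>X\<close> along \<open>s \<le> t \<le> u\<close>.\<close>

lemma simplex_map_in_sdiagram_hom:
  assumes X: "simplicial_diagram X" and \<omega>: "\<omega> \<in> simplices (stage X s) n"
  shows "simplex_map X s n \<omega> \<in> sdiagram_hom (free_diagram s (standard_simplex n)) X"
proof -
  note K = simplicial_set_stage[OF X, of s]
  let ?\<sigma> = "simplex_map X s n \<omega>" and ?L = "free_diagram s (standard_simplex n)"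
  have 1: "?\<sigma> u \<in> sset_hom (stage ?L u) (stage X u)" for u
  proof (cases "s \<le> u")
    case True
    note T = transition_sset_hom[OF X True]
    have "?\<sigma> u k \<in> ordinal_hom k n \<rightarrow>\<^sub>E simplices (stage X u) k" for k
      using True sset_hom_in_simplices[OF T sact_in_simplices[OF K _ \<omega>]]
      by (auto simp: simplex_map_def)
    moreover have "?\<sigma> u l (compose {..l} \<alpha> \<theta>) = sact (stage X u) l m \<theta> (?\<sigma> u m \<alpha>)"
      if "\<theta> \<in> ordinal_hom l m" "\<alpha> \<in> ordinal_hom m n" for l m \<theta> \<alpha>
      using that True
      by (simp add: simplex_map_apply compose_in_ordinal_hom sact_compose[OF K _ _ \<omega>]
          sset_hom_sact[OF T] sact_in_simplices[OF K _ \<omega>])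
    ultimately show ?thesis
      using True by (auto simp: sset_hom_def free_diagram_standard_simplex_simps)
  next
    case False
    then show ?thesis
      by (auto simp: sset_hom_def free_diagram_standard_simplex_simps simplex_map_def)
  qed
  have 2: "?\<sigma> u k (transition ?L t u k \<alpha>) = transition X t u k (?\<sigma> t k \<alpha>)"
    if "t \<le> u" "\<alpha> \<in> simplices (stage ?L t) k" for t u k \<alpha>
  proof -
    \<comment> \<open>The stages below \<open>s\<close> are empty, so the existence of
      \<open>\<alpha>\<close> forces \<open>s \<le> t\<close>.\<close>
    have "s \<le> t" "\<alpha> \<in> ordinal_hom k n"
      using that(2) by (auto simp: free_diagram_standard_simplex_simps split: if_splits)
    then show ?thesis
      using that(1) transition_transition[OF X \<open>s \<le> t\<close> \<open>t \<le> u\<close> sact_in_simplices[OF K _ \<omega>]]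
      by (simp add: free_diagram_standard_simplex_simps simplex_map_apply order_trans[OF _ that(1)])
  qed
  show ?thesis
    unfolding sdiagram_hom_def by (simp add: 1 2)
qed

text \<open>Naturality of the Yoneda correspondence: composing a classifying map with
  \<open>f\<close> classifies the image simplex. It is what makes triangles over \<open>X\<close>
  commute.\<close>

lemma sdiagram_hom_simplex_map:
  assumes X: "simplicial_diagram X" and f: "f \<in> sdiagram_hom X Y"
    and \<omega>: "\<omega> \<in> simplices (stage X s) n" and "s \<le> u" "\<alpha> \<in> ordinal_hom k n"
  shows "f u k (simplex_map X s n \<omega> u k \<alpha>) = simplex_map Y s n (f s n \<omega>) u k \<alpha>"
proof -
  let ?\<beta> = "sact (stage X s) k n \<alpha> \<omega>"
  have "?\<beta> \<in> simplices (stage X s) k"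
    by (rule sact_in_simplices[OF simplicial_set_stage[OF X] assms(5) \<omega>])
  then have "f u k (transition X s u k ?\<beta>) = transition Y s u k (f s k ?\<beta>)"
    by (rule sdiagram_hom_transition[OF f assms(4)])
  also have "f s k ?\<beta> = sact (stage Y s) k n \<alpha> (f s n \<omega>)"
    by (rule sset_hom_sact[OF sdiagram_hom_sset_hom[OF f] assms(5) \<omega>])
  finally show ?thesis
    using assms(4,5) by (simp add: simplex_map_apply)
qed

section \<open>Objects of the category of simplices and their vertices at level
  \<open>\<infinity>\<close>\<close>

lemma simplex_map_in_simplex_objects:
  "\<lbrakk>simplicial_diagram X; \<omega> \<in> simplices (stage X s) n\<rbrakk>
    \<Longrightarrow> (s, n, simplex_map X s n \<omega>) \<in> simplex_objects X"
  by (simp add: simplex_objects_def simplex_map_in_sdiagram_hom)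

lemma simplex_object_in_simplices:
  assumes "(s, n, \<sigma>) \<in> simplex_objects X" "s \<le> u" "\<alpha> \<in> ordinal_hom k n"
  shows "\<sigma> u k \<alpha> \<in> simplices (stage X u) k"
proof -
  have "\<sigma> u \<in> sset_hom (stage (free_diagram s (standard_simplex n)) u) (stage X u)"
    using assms(1) by (simp add: simplex_objects_def sdiagram_hom_sset_hom)
  moreover have "\<alpha> \<in> simplices (stage (free_diagram s (standard_simplex n)) u) k"
    using assms(2,3) by (simp add: free_diagram_standard_simplex_simps)
  ultimately show ?thesis
    by (rule sset_hom_in_simplices)
qed

lemma vertex_cocone_in_vertices:
  "\<lbrakk>(s, n, \<sigma>) \<in> simplex_objects X; i \<le> n\<rbrakk> \<Longrightarrow> vertex_cocone (s, n, \<sigma>) i \<in> vertices (stage X \<infinity>)"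
  by (simp add: vertices_def simplex_object_in_simplices point_map_in_ordinal_hom)

text \<open>Naturality of the transition moves the vertex operator to level
  \<open>\<infinity>\<close>, where it matches the endpoints used in polygonal paths.\<close>

lemma vertex_cocone_simplex_map:
  assumes X: "simplicial_diagram X" and \<omega>: "\<omega> \<in> simplices (stage X s) n" and "i \<le> n"
  shows "vertex_cocone (s, n, simplex_map X s n \<omega>) i =
    sact (stage X \<infinity>) 0 n (point_map i) (transition X s \<infinity> n \<omega>)"
  using assms(3) sset_hom_sact[OF transition_sset_hom[OF X, of s \<infinity>] _ \<omega>]
  by (simp add: simplex_map_apply point_map_in_ordinal_hom)

text \<open>Shows that the cocone maps jointly cover the vertices of
  \<open>X\<^sub>\<infinity>\<close>, which gives uniqueness in the universal property.\<close>

lemma vertex_cocone_vertex_map: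
  assumes X: "simplicial_diagram X" and v: "v \<in> vertices (stage X \<infinity>)"
  shows "vertex_cocone (\<infinity>, 0, simplex_map X \<infinity> 0 v) 0 = v"
proof -
  have "point_map 0 = (\<lambda>i\<in>{..0}. i)"
    by (auto simp: point_map_def)
  moreover have "sact (stage X \<infinity>) 0 0 (\<lambda>i\<in>{..0}. i) v = v"
    using v by (intro sact_ident simplicial_set_stage[OF X]) (simp add: vertices_def)
  ultimately have "sact (stage X \<infinity>) 0 0 (point_map 0) v = v"
    by (simp only:)
  then show ?thesis
    using v X by (simp only: vertex_cocone_simplex_map vertices_def transition_self le_refl)
qed

text \<open>The vertex function is read off at level \<open>t\<close> and the cocone at level
  \<open>\<infinity>\<close>; compatibility of \<open>\<Theta>\<close> with transitions identifies
  the two.\<close>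

lemma vertex_cocone_vertex_function:
  assumes \<Theta>: "\<Theta> \<in> simplex_homs (t, m, \<tau>) (s, n, \<sigma>)" and "i \<le> m"
  shows "vertex_cocone (s, n, \<sigma>) (vertex_function (t, m, \<tau>) (s, n, \<sigma>) \<Theta> i) =
    vertex_cocone (t, m, \<tau>) i"
proof -
  let ?L = "free_diagram t (standard_simplex m)" and ?M = "free_diagram s (standard_simplex n)"
  have h: "\<Theta> \<in> sdiagram_hom ?L ?M"
    and over: "\<sigma> \<infinity> 0 (\<Theta> \<infinity> 0 (point_map i)) = \<tau> \<infinity> 0 (point_map i)"
    using \<Theta> point_map_in_ordinal_hom[OF \<open>i \<le> m\<close>]
    by (auto simp: free_diagram_standard_simplex_simps)
  have i: "point_map i \<in> simplices (stage ?L t) 0"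
    using point_map_in_ordinal_hom[OF \<open>i \<le> m\<close>] by (simp add: free_diagram_standard_simplex_simps)
  have "\<Theta> t 0 (point_map i) \<in> simplices (stage ?M t) 0"
    by (rule sset_hom_in_simplices[OF sdiagram_hom_sset_hom[OF h] i])
  \<comment> \<open>The relation \<open>s \<le> t\<close> is implicit in \<open>\<Theta>\<close>:
    level \<open>t\<close> of its target contains a simplex, hence is not empty.\<close>
  then have st: "s \<le> t" and \<alpha>: "\<Theta> t 0 (point_map i) \<in> ordinal_hom 0 n"
    by (auto simp: free_diagram_standard_simplex_simps split: if_splits)
  have "\<Theta> \<infinity> 0 (point_map i) = \<Theta> t 0 (point_map i)"
    using sdiagram_hom_transition[OF h _ i, of \<infinity>] st \<alpha> point_map_in_ordinal_hom[OF \<open>i \<le> m\<close>]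
    by (simp add: free_diagram_standard_simplex_simps)
  then show ?thesis
    using over ordinal_hom_0_le[OF \<alpha>] \<open>i \<le> m\<close> by (simp add: point_map_eq[OF \<alpha>])
qed

text \<open>\<open>\<Theta>\<close> is the Yoneda map of the vertex \<open>i\<close> of
  \<open>L\<^sub>s\<Delta>\<^sup>n\<close> taken at level \<open>\<infinity>\<close>; naturality of
  the correspondence along \<open>\<sigma>\<close> shows that it lies over \<open>X\<close>.\<close>

lemma vertex_inclusion:
  assumes "(s, n, \<sigma>) \<in> simplex_objects X" "i \<le> n"
  defines "\<Theta> \<equiv> simplex_map (free_diagram s (standard_simplex n)) \<infinity> 0 (point_map i)"
    and "v \<equiv> vertex_cocone (s, n, \<sigma>) i"
  shows "\<Theta> \<in> simplex_homs (\<infinity>, 0, simplex_map X \<infinity> 0 v) (s, n, \<sigma>)"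
    and "vertex_function (\<infinity>, 0, simplex_map X \<infinity> 0 v) (s, n, \<sigma>) \<Theta> 0 = i"
proof -
  let ?L = "free_diagram s (standard_simplex n)"
  have L: "simplicial_diagram ?L"
    by (simp add: simplicial_diagram_free_diagram simplicial_set_standard_simplex)
  have \<sigma>: "\<sigma> \<in> sdiagram_hom ?L X"
    using assms(1) by (simp add: simplex_objects_def)
  have i: "point_map i \<in> simplices (stage ?L \<infinity>) 0"
    using assms(2) by (simp add: free_diagram_standard_simplex_simps point_map_in_ordinal_hom)
  have "\<sigma> u k (\<Theta> u k \<alpha>) = simplex_map X \<infinity> 0 v u k \<alpha>"
    if "\<infinity> \<le> u" "\<alpha> \<in> ordinal_hom k 0" for u k \<alpha>
    using sdiagram_hom_simplex_map[OF L \<sigma> i that] assms(2) by (simp add: \<Theta>_def v_def)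
  then show "\<Theta> \<in> simplex_homs (\<infinity>, 0, simplex_map X \<infinity> 0 v) (s, n, \<sigma>)"
    using simplex_map_in_sdiagram_hom[OF L i]
    by (auto simp: \<Theta>_def free_diagram_standard_simplex_simps split: if_splits)
  have "compose {..0} (point_map i) (point_map 0) = point_map i"
    using compose_point_map[of 0 0 "point_map i"] by (simp add: point_map_def)
  then show "vertex_function (\<infinity>, 0, simplex_map X \<infinity> 0 v) (s, n, \<sigma>) \<Theta> 0 = i"
    using assms(2)
    by (simp add: \<Theta>_def simplex_map_apply point_map_in_ordinal_hom
        free_diagram_standard_simplex_simps) (simp add: point_map_def)
qed

section \<open>The path metric\<close>

lemma joins_sym: "joins K e x y \<longleftrightarrow> joins K e y x"
  by (auto simp: joins_def)

lemma polygonal_path_append: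
  "\<lbrakk>polygonal_path X x P y; polygonal_path X y Q z\<rbrakk> \<Longrightarrow> polygonal_path X x (P @ Q) z"
  by (induction X x P y rule: polygonal_path.induct) auto

text \<open>Each edge may be crossed in either direction, so reversing the list suffices.\<close>

lemma polygonal_path_rev: "polygonal_path X x P y \<Longrightarrow> polygonal_path X y (rev P) x"
proof (induction X x P y rule: polygonal_path.induct)
  case (2 X x s \<omega> P y)
  then obtain z where z: "\<omega> \<in> simplices (stage X s) 1"
    "joins (stage X \<infinity>) (transition X s \<infinity> 1 \<omega>) x z" "polygonal_path X z P y"
    by auto
  have "polygonal_path X z [(s, \<omega>)] x"
    using z joins_sym by fastforce
  then show ?case
    using 2 z polygonal_path_append by fastforce
qed simp

lemma path_length_append: "path_length (P @ Q) = path_length P + path_length Q"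
  by (simp add: path_length_def)

lemma path_length_rev: "path_length (rev P) = path_length P"
  by (simp add: path_length_def rev_map[symmetric] sum_list_rev)

text \<open>An edge of either orientation lies in the generated equivalence. Hence no path links
  distinct components.\<close>

lemma polygonal_path_same_path_component:
  assumes "simplicial_diagram X" "polygonal_path X x P y"
  shows "same_path_component (stage X \<infinity>) x y"
  using assms
proof (induction X x P y rule: polygonal_path.induct)
  case (1 X x y)
  then show ?case by (simp add: same_path_component_def)
next
  case (2 X x s \<omega> P y)
  then obtain z where z: "\<omega> \<in> simplices (stage X s) 1"
    "joins (stage X \<infinity>) (transition X s \<infinity> 1 \<omega>) x z" "polygonal_path X z P y"
    by auto
  have "transition X s \<infinity> 1 \<omega> \<in> simplices (stage X \<infinity>) 1"
    using sset_hom_in_simplices[OF transition_sset_hom[OF 2(2)]] z(1) by simp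
  then have "same_path_component (stage X \<infinity>) x z"
    using z(2) unfolding same_path_component_def joins_def
    by (auto intro: r_into_equivclp converse_r_into_equivclp)
  then show ?case
    using 2 z unfolding same_path_component_def by (blast intro: equivclp_trans)
qed

text \<open>The infimum of the empty set is \<open>\<infinity>\<close>, so this single formula
  covers distinct path components as well.\<close>

definition path_dist :: "'a sdiagram \<Rightarrow> 'a \<Rightarrow> 'a \<Rightarrow> ennreal" where
  "path_dist X x y = (INF P\<in>{P. polygonal_path X x P y}. path_length P)"

lemma path_dist_le: "polygonal_path X x P y \<Longrightarrow> path_dist X x y \<le> path_length P"
  by (auto simp: path_dist_def intro: INF_lower)

lemma path_dist_greatest:
  "(\<And>P. polygonal_path X x P y \<Longrightarrow> c \<le> path_length P) \<Longrightarrow> c \<le> path_dist X x y"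
  by (auto simp: path_dist_def intro: INF_greatest)

lemma path_dist_eq:
  assumes "simplicial_diagram X"
  shows "(if same_path_component (stage X \<infinity>) x y
      then INF P\<in>{P. polygonal_path X x P y}. path_length P else \<infinity>) = path_dist X x y"
proof (cases "same_path_component (stage X \<infinity>) x y")
  case False
  then have "{P. polygonal_path X x P y} = {}"
    using polygonal_path_same_path_component[OF assms] by blast
  then have "path_dist X x y = \<infinity>"
    unfolding path_dist_def by (simp only: image_empty) simp
  with False show ?thesis
    by simp
qed (simp add: path_dist_def)

section \<open>The pseudo-metric axioms for \<open>path_dist\<close>\<close>

lemma path_dist_self: "path_dist X x x = 0"
  using path_dist_le[of X x "[]" x] by (simp add: path_length_def)

lemma path_dist_sym: "path_dist X x y = path_dist X y x"
proof -
  have le: "path_dist X x y \<le> path_dist X y x" for x y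
    by (metis path_dist_greatest path_dist_le path_length_rev polygonal_path_rev)
  show ?thesis
    by (rule antisym[OF le le])
qed

text \<open>For finite \<open>a\<close> the summand is moved to the left by subtraction; for
  \<open>a = top\<close> the right side is \<open>top\<close>. The set \<open>I\<close> may be
  empty, as it is when no path exists.\<close>

lemma ennreal_le_add_INF:
  fixes a c :: ennreal
  assumes "\<And>i. i \<in> I \<Longrightarrow> c \<le> a + f i"
  shows "c \<le> a + (INF i\<in>I. f i)"
proof (cases "a = top")
  case False
  then have "c - a \<le> (INF i\<in>I. f i)"
    using assms by (intro INF_greatest) (simp add: ennreal_minus_le_iff)
  with False show ?thesis
    by (simp add: ennreal_minus_le_iff)
qed simp

text \<open>Concatenated paths have added lengths; the two infima are then taken one after the
  other.\<close>

lemma path_dist_triangle: "path_dist X x z \<le> path_dist X x y + path_dist X y z"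
proof -
  have "path_dist X x z \<le> path_length P + path_dist X y z" if P: "polygonal_path X x P y" for P
    unfolding path_dist_def[of X y z]
    using path_dist_le[OF polygonal_path_append[OF P]]
    by (intro ennreal_le_add_INF) (simp add: path_length_append)
  \<comment> \<open>The summands are swapped so that the infimum still to be taken stands on the
    right.\<close>
  then have "path_dist X x z \<le> path_dist X y z + path_dist X x y"
    unfolding path_dist_def[of X x y]
    by (intro ennreal_le_add_INF) (simp add: add.commute)
  then show ?thesis
    by (simp add: add.commute)
qed

section \<open>The universal cocone\<close>

definition path_space :: "'a sdiagram \<Rightarrow> 'a ep_space" where
  "path_space X = \<lparr>points = vertices (stage X \<infinity>), edist = path_dist X\<rparr>"

lemma ep_metric_space_path_space: "ep_metric_space (path_space X)"
  by (simp add: ep_metric_space_def path_space_def path_dist_self path_dist_triangle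
      path_dist_sym[of X x y for x y])

text \<open>The edge of the simplex from \<open>i\<close> to \<open>j\<close> is a polygonal path
  with one step of weight \<open>s\<close>.\<close>

lemma path_dist_vertex_cocone_le:
  assumes X: "simplicial_diagram X" and o: "(s, n, \<sigma>) \<in> simplex_objects X"
    and "i < j" "j \<le> n"
  shows "path_dist X (vertex_cocone (s, n, \<sigma>) i) (vertex_cocone (s, n, \<sigma>) j) \<le> s"
proof -
  let ?L = "free_diagram s (standard_simplex n)"
  \<comment> \<open>The edge of \<open>\<Delta>\<^sup>n\<close> with endpoints \<open>i\<close> and
    \<open>j\<close>; it is monotone because \<open>i < j\<close>.\<close>
  define e where "e = (\<lambda>k\<in>{..1::nat}. if k = 0 then i else j)"
  have \<sigma>: "\<sigma> \<in> sdiagram_hom ?L X"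
    using o by (simp add: simplex_objects_def)
  have e: "e \<in> ordinal_hom 1 n"
    using assms by (auto simp: e_def ordinal_hom_def mono_on_def)
  \<comment> \<open>The path records the edge at level \<open>s\<close>, which fixes its weight,
    while its endpoints are compared at level \<open>\<infinity>\<close>.\<close>
  have trans: "transition X s \<infinity> 1 (\<sigma> s 1 e) = \<sigma> \<infinity> 1 e"
    using sdiagram_hom_transition[OF \<sigma>, of s \<infinity> e 1] e
    by (simp add: free_diagram_standard_simplex_simps)
  have "sact (stage X \<infinity>) 0 1 (point_map k) (\<sigma> \<infinity> 1 e) = \<sigma> \<infinity> 0 (point_map (e k))" if "k \<le> 1" for k
    using sset_hom_sact[OF sdiagram_hom_sset_hom[OF \<sigma>], of "point_map k" 0 1 e \<infinity>]
      point_map_in_ordinal_hom[OF that] compose_point_map[OF that, of e] e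
    by (simp add: free_diagram_standard_simplex_simps)
  from this[of 0] this[of 1]
  have "joins (stage X \<infinity>) (\<sigma> \<infinity> 1 e) (vertex_cocone (s, n, \<sigma>) i) (vertex_cocone (s, n, \<sigma>) j)"
    using assms by (simp add: joins_def initial_vertex_def terminal_vertex_def e_def)
  then have "polygonal_path X (vertex_cocone (s, n, \<sigma>) i) [(s, \<sigma> s 1 e)] (vertex_cocone (s, n, \<sigma>) j)"
    using simplex_object_in_simplices[OF o _ e, of s] trans by simp
  from path_dist_le[OF this] show ?thesis
    by (simp add: path_length_def)
qed

lemma ep_cocone_vertex_cocone:
  assumes X: "simplicial_diagram X"
  shows "ep_cocone (simplex_objects X) simplex_homs simplex_space vertex_function
    (path_space X) vertex_cocone"
proof -
  have hom: "vertex_cocone (s, n, \<sigma>) \<in> ep_hom (simplex_space (s, n, \<sigma>)) (path_space X)"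
    if o: "(s, n, \<sigma>) \<in> simplex_objects X" for s n \<sigma>
  proof -
    \<comment> \<open>For \<open>j < i\<close> the bound comes from the swapped pair by
      symmetry.\<close>
    have "path_dist X (vertex_cocone (s, n, \<sigma>) i) (vertex_cocone (s, n, \<sigma>) j) \<le> s"
      if "i \<le> n" "j \<le> n" "i \<noteq> j" for i j
      using that path_dist_vertex_cocone_le[OF X o, of i j] path_dist_vertex_cocone_le[OF X o, of j i]
        path_dist_sym[of X "vertex_cocone (s, n, \<sigma>) i" "vertex_cocone (s, n, \<sigma>) j"]
      by (cases "i < j") (simp_all del: vertex_cocone.simps)
    moreover have "vertex_cocone (s, n, \<sigma>) \<in> {..n} \<rightarrow>\<^sub>E vertices (stage X \<infinity>)"
      using vertex_cocone_in_vertices[OF o] by (intro PiE_I) auto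
    ultimately show ?thesis
      by (simp add: ep_hom_def path_space_def uniform_space_def path_dist_self del: vertex_cocone.simps)
  qed
  have "vertex_cocone k (vertex_function j k \<Theta> i) = vertex_cocone j i"
    if "\<Theta> \<in> simplex_homs j k" "i \<in> points (simplex_space j)" for j k \<Theta> i
    using that vertex_cocone_vertex_function
    by (cases j; cases k) (simp add: uniform_space_def
        del: vertex_cocone.simps vertex_function.simps simplex_homs.simps)
  then show ?thesis
    using hom ep_metric_space_path_space
    by (auto simp: ep_cocone_def simp del: vertex_cocone.simps vertex_function.simps
        simplex_homs.simps simplex_space.simps)
qed

text \<open>The cocone condition at the morphism of \<open>vertex_inclusion\<close> shows that the
  value at \<open>i\<close> depends only on the vertex of \<open>X\<^sub>\<infinity>\<close> that
  \<open>i\<close> represents.\<close>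

lemma cocone_factors_on_vertices:
  assumes X: "simplicial_diagram X"
    and f: "ep_cocone (simplex_objects X) simplex_homs simplex_space vertex_function Z f"
    and o: "(s, n, \<sigma>) \<in> simplex_objects X" and "i \<le> n"
  shows "f (\<infinity>, 0, simplex_map X \<infinity> 0 (vertex_cocone (s, n, \<sigma>) i)) 0 = f (s, n, \<sigma>) i"
proof -
  let ?v = "vertex_cocone (s, n, \<sigma>) i"
  have "(\<infinity>, 0, simplex_map X \<infinity> 0 ?v) \<in> simplex_objects X"
    using vertex_cocone_in_vertices[OF o \<open>i \<le> n\<close>] simplex_map_in_simplex_objects[OF X]
    unfolding vertices_def by blast
  moreover have "0 \<in> points (simplex_space (\<infinity>, 0, simplex_map X \<infinity> 0 ?v))"
    by (simp add: uniform_space_def)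
  ultimately show ?thesis
    using f o vertex_inclusion[OF o \<open>i \<le> n\<close>] unfolding ep_cocone_def by metis
qed

text \<open>Maximality of the path metric: the edge bounds add up along the path by the triangle
  inequality. Membership of \<open>y\<close> is carried through the induction because the axioms of
  \<open>Z\<close> hold only on \<open>points Z\<close>.\<close>

lemma edist_le_path_length:
  assumes X: "simplicial_diagram X" and Z: "ep_metric_space Z"
    and h: "h \<in> vertices (stage X \<infinity>) \<rightarrow> points Z"
    and edge: "\<And>s \<omega>. \<omega> \<in> simplices (stage X s) 1 \<Longrightarrow>
      edist Z (h (initial_vertex (stage X \<infinity>) (transition X s \<infinity> 1 \<omega>)))
        (h (terminal_vertex (stage X \<infinity>) (transition X s \<infinity> 1 \<omega>))) \<le> s"
    and "polygonal_path X x P y" "x \<in> vertices (stage X \<infinity>)"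
  shows "edist Z (h x) (h y) \<le> path_length P \<and> y \<in> vertices (stage X \<infinity>)"
  using assms(5,6)
proof (induction P arbitrary: x)
  case Nil
  then show ?case
    using Z h by (auto simp: ep_metric_space_def path_length_def)
next
  case (Cons a P)
  obtain s \<omega> where a: "a = (s, \<omega>)" by fastforce
  obtain z where z: "\<omega> \<in> simplices (stage X s) 1"
    "joins (stage X \<infinity>) (transition X s \<infinity> 1 \<omega>) x z" "polygonal_path X z P y"
    using Cons.prems(1) a by auto
  have "transition X s \<infinity> 1 \<omega> \<in> simplices (stage X \<infinity>) 1"
    using sset_hom_in_simplices[OF transition_sset_hom[OF X]] z(1) by simp
  then have "z \<in> vertices (stage X \<infinity>)"
    using z(2) sact_in_simplices[OF simplicial_set_stage[OF X]] point_map_in_ordinal_hom[of _ 1]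
    by (auto simp: joins_def initial_vertex_def terminal_vertex_def vertices_def)
  moreover from this have IH: "edist Z (h z) (h y) \<le> path_length P" "y \<in> vertices (stage X \<infinity>)"
    using Cons.IH z(3) by auto
  ultimately have pts: "h x \<in> points Z" "h y \<in> points Z" "h z \<in> points Z"
    using h Cons.prems(2) by auto
  \<comment> \<open>An edge crossed backwards uses the symmetry of \<open>edist Z\<close>.\<close>
  have "edist Z (h x) (h z) \<le> s"
    using z(2) edge[OF z(1)] Z pts by (auto simp: joins_def ep_metric_space_def)
  then have "edist Z (h x) (h z) + edist Z (h z) (h y) \<le> path_length (a # P)"
    using IH(1) by (simp add: path_length_def a add_mono)
  then show ?case
    using Z pts IH(2) unfolding ep_metric_space_def by (meson order_trans)
qed

lemma is_realization_path_space:
  assumes X: "simplicial_diagram X"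
  shows "is_realization TYPE('c) X (path_space X) vertex_cocone"
  unfolding is_realization_def is_ep_colimit_def
proof (intro conjI allI impI ep_cocone_vertex_cocone[OF X])
  fix Z :: "'c ep_space" and f
  assume f: "ep_cocone (simplex_objects X) simplex_homs simplex_space vertex_function Z f"
  then have Z: "ep_metric_space Z"
    and fhom: "\<And>j. j \<in> simplex_objects X \<Longrightarrow> f j \<in> ep_hom (simplex_space j) Z"
    by (auto simp: ep_cocone_def)
  let ?V = "vertices (stage X \<infinity>)"
  \<comment> \<open>The value at \<open>v\<close> is forced by the object classifying
    \<open>v\<close>; the restriction to \<open>?V\<close> makes \<open>h\<close>
    extensional.\<close>
  define h where "h = (\<lambda>v\<in>?V. f (\<infinity>, 0, simplex_map X \<infinity> 0 v) 0)"
  have obj: "(\<infinity>, 0, simplex_map X \<infinity> 0 v) \<in> simplex_objects X" if "v \<in> ?V" for v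
    using simplex_map_in_simplex_objects[OF X] that unfolding vertices_def by blast
  have hf: "h (vertex_cocone (s, n, \<sigma>) i) = f (s, n, \<sigma>) i"
    if o: "(s, n, \<sigma>) \<in> simplex_objects X" and "i \<le> n" for s n \<sigma> i
    using cocone_factors_on_vertices[OF X f that] vertex_cocone_in_vertices[OF that]
    by (simp add: h_def del: vertex_cocone.simps)
  have hZ: "h v \<in> points Z" if "v \<in> ?V" for v
    using fhom[OF obj[OF that]] that by (auto simp: h_def ep_hom_def uniform_space_def)
  have edge: "edist Z (h (initial_vertex (stage X \<infinity>) (transition X s \<infinity> 1 \<omega>)))
      (h (terminal_vertex (stage X \<infinity>) (transition X s \<infinity> 1 \<omega>))) \<le> s"
    if \<omega>: "\<omega> \<in> simplices (stage X s) 1" for s \<omega>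
  proof -
    \<comment> \<open>The edge is itself an object of the index category, and \<open>f ?j\<close>
      does not increase distances on \<open>U\<^sup>1\<^sub>s\<close>, where \<open>0\<close> and
      \<open>1\<close> have distance \<open>s\<close>.\<close>
    let ?j = "(s, 1, simplex_map X s 1 \<omega>)"
    have j: "?j \<in> simplex_objects X"
      using simplex_map_in_simplex_objects[OF X \<omega>] .
    have "edist Z (f ?j 0) (f ?j 1) \<le> s"
    proof -
      have "\<forall>a\<in>{..1}. \<forall>b\<in>{..1}. edist Z (f ?j a) (f ?j b) \<le> (if a = b then 0 else s)"
        using fhom[OF j] by (simp add: ep_hom_def uniform_space_def)
      from this[rule_format, of 0 1] show ?thesis
        by simp
    qed
    moreover have "h (initial_vertex (stage X \<infinity>) (transition X s \<infinity> 1 \<omega>)) = f ?j 0"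
      using hf[OF j, of 0] vertex_cocone_simplex_map[OF X \<omega>, of 0] by (simp add: initial_vertex_def)
    moreover have "h (terminal_vertex (stage X \<infinity>) (transition X s \<infinity> 1 \<omega>)) = f ?j 1"
      using hf[OF j, of 1] vertex_cocone_simplex_map[OF X \<omega>, of 1] by (simp add: terminal_vertex_def)
    ultimately show ?thesis by simp
  qed
  have "edist Z (h x) (h y) \<le> path_dist X x y" if "x \<in> ?V" for x y
    using edist_le_path_length[OF X Z _ edge _ that] hZ
    by (intro path_dist_greatest) blast
  then have hom: "h \<in> ep_hom (path_space X) Z"
    using hZ by (auto simp: ep_hom_def path_space_def intro: PiE_I) (simp add: h_def)
  show "\<exists>!h. h \<in> ep_hom (path_space X) Z \<and>
      (\<forall>j\<in>simplex_objects X. \<forall>x\<in>points (simplex_space j). h (vertex_cocone j x) = f j x)"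
  proof (rule ex1I[of _ h])
    show "h \<in> ep_hom (path_space X) Z \<and>
        (\<forall>j\<in>simplex_objects X. \<forall>x\<in>points (simplex_space j). h (vertex_cocone j x) = f j x)"
      using hom hf by (auto simp: uniform_space_def simp del: vertex_cocone.simps)
  next
    fix h'
    assume h': "h' \<in> ep_hom (path_space X) Z \<and>
        (\<forall>j\<in>simplex_objects X. \<forall>x\<in>points (simplex_space j). h' (vertex_cocone j x) = f j x)"
    show "h' = h"
    proof (rule extensionalityI[of _ ?V])
      show "h' \<in> extensional ?V" "h \<in> extensional ?V"
        using h' hom by (auto simp: ep_hom_def path_space_def PiE_def)
      fix v assume v: "v \<in> ?V"
      \<comment> \<open>Since \<open>v\<close> is the image of \<open>0\<close> under the cocone map
        at its classifying object, the value of \<open>h'\<close> at \<open>v\<close> is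
        prescribed.\<close>
      have "h' (vertex_cocone (\<infinity>, 0, simplex_map X \<infinity> 0 v) 0) = f (\<infinity>, 0, simplex_map X \<infinity> 0 v) 0"
        using h' obj[OF v] by (auto simp: uniform_space_def simp del: vertex_cocone.simps)
      then show "h' v = h v"
        unfolding vertex_cocone_vertex_map[OF X v] using v by (simp add: h_def)
    qed
  qed
qed

theorem proposition7:
  fixes X :: "'a sdiagram"
  assumes "simplicial_diagram X"
  shows "is_realization TYPE('c) X
    \<lparr>points = vertices (stage X \<infinity>),
     edist = (\<lambda>x y. if same_path_component (stage X \<infinity>) x y
                    then INF P\<in>{P. polygonal_path X x P y}. path_length P
                    else \<infinity>)\<rparr>
    vertex_cocone"
  \<comment> \<open>By \<open>path_dist_eq\<close> the case distinction on path components collapses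
    to \<open>path_dist\<close>.\<close>
  using is_realization_path_space[OF assms, where 'c = 'c]
  unfolding path_dist_eq[OF assms] path_space_def .

end
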